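(* Let $\lambda_g,p_g,p_p>0$, $\alpha>2$, $\eta=p_p/p_g$, $s=1/\sqrt{\lambda_g}$, $S_0=(-s/2,s/2)\times(-s/2,s/2)$, and let $\Phi_g$ be the random shifted square grid of intensity $\lambda_g$ with shift $U$. For $\xi>0$, conditionally on $R>0$ with $\nu_2(S_0\setminus B(0,R\eta^{-1/\alpha}))>0$, and conditionally on $U$, respectively, the Laplace transforms of the interference from $\Phi_g^{!\sim R\eta^{-1/\alpha}}$ and from $\Phi_g\setminus\{U\}$ are $$\mathcal{L}_{I_{\Phi_g^{!\sim R\eta^{-1/\alpha}}}}(\xi)=\int_{S_0\setminus B(0,R\eta^{-1/\alpha})}\ \prod_{(z_1,z_2)\in\mathbb{Z}^2}\frac{1}{1+p_g\xi\|u'+s(z_1,z_2)\|^{-\alpha}}\ \mathbf{P}_{U'}(du'),$$ $$\mathcal{L}_{I_{\Phi_g\setminus\{U\}}}(\xi)=\prod_{(z_1,z_2)\in\mathbb{Z}^2\setminus\{(0,0)\}}\frac{1}{1+p_g\xi\|U+s(z_1,z_2)\|^{-\alpha}},$$ where $U'$ is uniformly distributed on $S_0\setminus B(0,R\eta^{-1/\alpha})$ and $\mathbf{P}_{U'}$ is its law.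
   Context: Random shifted grid: with $U$ uniform on $[-s/2,s/2]^2$, $\Phi_g=\{sk+U:k\in\mathbb{Z}^2\}$ (a single common shift); $U$ is then the grid point nearest to the origin. $B(x,r)$ is the ball of radius $r$ centered at $x$ and $\nu_2$ is area. For $r>0$, $\Phi_g^{!\sim r}$ denotes $\Phi_g$ conditioned on having no points in $B(0,r)$. The interference from a process $\Psi$ of grid base stations is $I_\Psi=\sum_{X\in\Psi}p_gH_X\|X\|^{-\alpha}$ with $H_X$ i.i.d. exponential with mean one, independent of the points. $\mathcal{L}_I(\xi)=\mathbf{E}[e^{-\xi I}]$, computed for the given value of $R$ (the distance from the origin to the serving Poisson base station, independent of $\Phi_g$) in the first formula, and as a conditional expectation given $U$ (location of the serving grid base station) in the second. *)

theory Defs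
  imports "HOL-Probability.Probability"
begin

text \<open>
  Points of the plane are elements of \<^typ>\<open>real \<times> real\<close>, whose library norm is Euclidean and whose
  \<^const>\<open>lborel\<close> is planar Lebesgue measure.
\<close>

definition lattice_point :: "real \<Rightarrow> int \<times> int \<Rightarrow> real \<times> real" where
  "lattice_point s z = (s * of_int (fst z), s * of_int (snd z))"

definition shifted_grid :: "real \<Rightarrow> real \<times> real \<Rightarrow> (real \<times> real) set" where
  "shifted_grid s u = range (\<lambda>k. lattice_point s k + u)"

definition closed_cell :: "real \<Rightarrow> (real \<times> real) set" where
  "closed_cell s = {- s / 2 .. s / 2} \<times> {- s / 2 .. s / 2}"

definition open_cell :: "real \<Rightarrow> (real \<times> real) set" where
  "open_cell s = {- s / 2 <..< s / 2} \<times> {- s / 2 <..< s / 2}"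

text \<open>
  A family \<open>h\<close> indexed by the integer lattice marks the grid points: the point \<open>s k + u\<close> carries
  the mark \<open>h k\<close>. For \<open>s \<noteq> 0\<close> the index \<open>k\<close> of a grid point is unique.
\<close>

definition grid_mark :: "real \<Rightarrow> real \<times> real \<Rightarrow> (int \<times> int \<Rightarrow> real) \<Rightarrow> real \<times> real \<Rightarrow> real" where
  "grid_mark s u h x = h (THE k. x = lattice_point s k + u)"

text \<open>
  The real-valued \<^const>\<open>infsum\<close> is \<open>0\<close> on a divergent sum. For exponential marks, \<open>\<alpha> > 2\<close> and a
  shifted grid (with or without some of its points removed) the sum converges almost surely, so
  this convention is only visible on a null set. Likewise \<open>0 powr (- \<alpha>) = 0\<close> matters only if
  the origin is one of the summed points.
\<close>

definition interference ::
  "real \<Rightarrow> real \<Rightarrow> (real \<times> real \<Rightarrow> real) \<Rightarrow> (real \<times> real) set \<Rightarrow> real" where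
  "interference p \<alpha> h \<Psi> = (\<Sum>\<^sub>\<infinity>x\<in>\<Psi>. p * h x * norm x powr (- \<alpha>))"

definition laplace_transform :: "'a measure \<Rightarrow> ('a \<Rightarrow> real) \<Rightarrow> real \<Rightarrow> real" where
  "laplace_transform M X \<xi> = (\<integral>\<omega>. exp (- \<xi> * X \<omega>) \<partial>M)"

text \<open>A version of the conditional Laplace transform of \<open>X\<close> given the random variable \<open>Y\<close>.\<close>

definition cond_laplace_transform ::
  "'a measure \<Rightarrow> ('a \<Rightarrow> 'b::topological_space) \<Rightarrow> ('a \<Rightarrow> real) \<Rightarrow> real \<Rightarrow> 'a \<Rightarrow> real" where
  "cond_laplace_transform M Y X \<xi> =
     real_cond_exp M (vimage_algebra (space M) Y borel) (\<lambda>\<omega>. exp (- \<xi> * X \<omega>))"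

text \<open>
  \<open>M\<close> conditioned on the grid with shift \<open>U\<close> having no point in the ball of radius \<open>r\<close> around the
  origin (\<^const>\<open>uniform_measure\<close> \<open>M A\<close> is \<open>M\<close> conditioned on the event \<open>A\<close>). Under this measure
  the grid has the conditional law; the marks, being independent of \<open>U\<close>, keep theirs and remain
  independent of the grid.
\<close>

definition void_conditioned ::
  "'a measure \<Rightarrow> real \<Rightarrow> ('a \<Rightarrow> real \<times> real) \<Rightarrow> real \<Rightarrow> 'a measure" where
  "void_conditioned M s U r =
     uniform_measure M {\<omega> \<in> space M. shifted_grid s (U \<omega>) \<inter> ball 0 r = {}}"

text \<open>
  Unordered infinite product: the limit of the finite subproducts, as in \<^const>\<open>infsum\<close>. For
  factors in the interval from 0 to 1 this limit always exists.
\<close>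

definition infprod :: "('a \<Rightarrow> real) \<Rightarrow> 'a set \<Rightarrow> real" where
  "infprod f A = Lim (finite_subsets_at_top A) (prod f)"

end

theory Submission
  imports Defs
begin

text \<open>
  For a fixed shift in the closed cell, \<open>\<alpha> > 2\<close> makes the path losses summable over the lattice, so
  the interference is almost surely a convergent series of independent exponential variables;
  dominated convergence along finite subsets gives its Laplace transform as an infinite product of
  the factors \<open>1 / (1 + p \<xi> \<parallel>u + s z\<parallel> powr - \<alpha>)\<close>. Independence of marks and shift together
  with Fubini's theorem then integrates this over any event determined by the shift, which is
  precisely the conditional expectation given the shift. For the void conditioning, the shift
  itself is the grid point nearest to the origin, so the conditioning event is
  \<open>U \<notin> ball 0 r\<close> up to a null set, and conditionally on it the shift is uniform on the
  rest of the cell.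
\<close>

subsection \<open>Sums and products over countable index sets\<close>

text \<open>Infinite sums and products are limits along the filter of finite subsets, while
  measurability of limits and dominated convergence work with sequences. The initial segments of an
  enumeration of \<open>A\<close> eventually contain every finite subset, so limits along that
  filter can be taken along them.\<close>

lemma countable_exhaustion:
  assumes "countable A"
  obtains E :: "nat \<Rightarrow> 'a set"
  where "filterlim E (finite_subsets_at_top A) sequentially" "\<And>n. finite (E n)" "\<And>n. E n \<subseteq> A"
proof
  define E where "E n = {x \<in> A. to_nat_on A x < n}" for n
  show fin: "finite (E n)" for n
  proof (rule inj_on_finite)
    show "inj_on (to_nat_on A) (E n)"
      using inj_on_to_nat_on[OF assms] by (rule inj_on_subset) (auto simp: E_def)
    show "to_nat_on A ` E n \<subseteq> {..<n}" by (auto simp: E_def)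
  qed auto
  show sub: "E n \<subseteq> A" for n by (auto simp: E_def)
  show "filterlim E (finite_subsets_at_top A) sequentially"
    unfolding filterlim_finite_subsets_at_top
  proof (intro allI impI)
    fix X assume X: "finite X \<and> X \<subseteq> A"
    have "\<forall>\<^sub>F n in sequentially. \<forall>x\<in>X. to_nat_on A x < n"
      using X by (intro eventually_ball_finite ballI eventually_gt_at_top) auto
    then show "\<forall>\<^sub>F n in sequentially. finite (E n) \<and> X \<subseteq> E n \<and> E n \<subseteq> A"
      by eventually_elim (use X fin sub in \<open>auto simp: E_def\<close>)
  qed
qed

text \<open>On the set where the series is summable the value is a limit of measurable partial sums,
  and elsewhere it is 0. The point is the measurability of that set: summability of reals means
  bounded absolute partial sums, a condition over countably many finite subsets and integer
  bounds.\<close>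

lemma borel_measurable_infsum:
  fixes f :: "'i \<Rightarrow> 'a \<Rightarrow> real"
  assumes A: "countable A" and f: "\<And>k. k \<in> A \<Longrightarrow> f k \<in> borel_measurable M"
  shows "(\<lambda>x. \<Sum>\<^sub>\<infinity>k\<in>A. f k x) \<in> borel_measurable M"
proof -
  obtain E where E: "filterlim E (finite_subsets_at_top A) sequentially"
      "\<And>n. finite (E n)" "\<And>n. E n \<subseteq> A"
    by (rule countable_exhaustion[OF A], rule that)
  define S where "S x \<longleftrightarrow> (\<exists>m::nat. \<forall>F\<in>{F. F \<subseteq> A \<and> finite F}. (\<Sum>k\<in>F. norm (f k x)) \<le> real m)" for x
  have S: "S x \<longleftrightarrow> (\<lambda>k. f k x) summable_on A" for x
  proof (subst summable_on_iff_abs_summable_on_real, unfold abs_summable_iff_bdd_above, rule iffI)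
    assume "S x"
    then show "bdd_above (sum (\<lambda>k. norm (f k x)) ` {F. F \<subseteq> A \<and> finite F})"
      unfolding S_def by (elim exE) (rule bdd_aboveI2, drule bspec)
  next
    assume "bdd_above (sum (\<lambda>k. norm (f k x)) ` {F. F \<subseteq> A \<and> finite F})"
    then obtain c where c: "\<And>F. F \<in> {F. F \<subseteq> A \<and> finite F} \<Longrightarrow> (\<Sum>k\<in>F. norm (f k x)) \<le> c"
      by (meson bdd_above_def imageI)
    obtain m :: nat where "c \<le> real m" using real_arch_simple by blast
    with c show "S x"
      unfolding S_def by (intro exI[of _ m] ballI) (rule order_trans)
  qed
  have cnt: "countable {F. F \<subseteq> A \<and> finite F}"
    using countable_Collect_finite_subset[OF A] by (simp add: conj_commute)
  have le_meas: "Measurable.pred M (\<lambda>x. (\<Sum>k\<in>F. norm (f k x)) \<le> real m)"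
    if "F \<in> {F. F \<subseteq> A \<and> finite F}" for F m
  proof -
    have [measurable]: "(\<lambda>x. \<Sum>k\<in>F. norm (f k x)) \<in> borel_measurable M"
      using that f by (intro borel_measurable_sum borel_measurable_norm) auto
    show ?thesis by measurable
  qed
  have S_meas [measurable]: "Measurable.pred M S"
    unfolding S_def
    by (intro pred_intros_countable(2) measurable_pred_countable[OF cnt] le_meas)
  \<comment> \<open>The case split is essential: along \<open>E\<close> the partial sums may also
    converge conditionally, where \<open>infsum\<close> has its default value 0.\<close>
  have eq: "(\<Sum>\<^sub>\<infinity>k\<in>A. f k x) = (if S x then lim (\<lambda>n. \<Sum>k\<in>E n. f k x) else 0)" for x
  proof (cases "S x")
    case True
    then have lim: "((\<lambda>F. \<Sum>k\<in>F. f k x) \<longlongrightarrow> (\<Sum>\<^sub>\<infinity>k\<in>A. f k x)) (finite_subsets_at_top A)"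
      by (intro infsum_tendsto) (simp add: S)
    have "(\<lambda>n. \<Sum>k\<in>E n. f k x) \<longlonglongrightarrow> (\<Sum>\<^sub>\<infinity>k\<in>A. f k x)"
      by (rule filterlim_compose[OF lim E(1)])
    with True show ?thesis by (simp add: limI)
  next
    case False
    then show ?thesis using S by (simp add: infsum_not_exists)
  qed
  have [measurable]: "(\<lambda>x. \<Sum>k\<in>E n. f k x) \<in> borel_measurable M" for n
    using E f by (intro borel_measurable_sum) auto
  show ?thesis
    unfolding eq by measurable
qed

text \<open>Factors in the unit interval make finite products decrease as the index set grows, so
  they converge to their infimum. This makes the \<open>Lim\<close> in \<open>infprod\<close> a
  genuine limit.\<close>

lemma infprod_tendsto:
  fixes f :: "'i \<Rightarrow> real"
  assumes "\<And>k. k \<in> A \<Longrightarrow> 0 \<le> f k \<and> f k \<le> 1"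
  shows "(prod f \<longlongrightarrow> infprod f A) (finite_subsets_at_top A)"
proof -
  define P where "P = prod f ` {F. finite F \<and> F \<subseteq> A}"
  have nn: "0 \<le> prod f F" if "F \<subseteq> A" for F
    using assms that by (intro prod_nonneg) auto
  have bdd: "bdd_below P"
    unfolding P_def using nn by (intro bdd_belowI2[where m=0]) auto
  have anti: "prod f G \<le> prod f F" if "F \<subseteq> G" "finite G" "G \<subseteq> A" for F G
  proof -
    have "prod f G = prod f (G - F) * prod f F"
      using that prod.subset_diff[of F G f] by simp
    also have "\<dots> \<le> 1 * prod f F"
      using assms that by (intro mult_right_mono prod_le_1 nn) auto
    finally show ?thesis by simp
  qed
  have "(prod f \<longlongrightarrow> Inf P) (finite_subsets_at_top A)"
  proof (rule order_tendstoI)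
    fix a assume "a < Inf P"
    moreover have "Inf P \<le> prod f F" if "finite F" "F \<subseteq> A" for F
      using that bdd by (intro cInf_lower) (auto simp: P_def)
    ultimately show "\<forall>\<^sub>F F in finite_subsets_at_top A. a < prod f F"
      by (intro eventually_finite_subsets_at_top_weakI) force
  next
    fix a assume "Inf P < a"
    moreover have "P \<noteq> {}" by (auto simp: P_def)
    ultimately obtain F where F: "finite F" "F \<subseteq> A" "prod f F < a"
      using cInf_lessD[of P a] by (auto simp: P_def)
    then show "\<forall>\<^sub>F G in finite_subsets_at_top A. prod f G < a"
      unfolding eventually_finite_subsets_at_top using anti
      by (intro exI[of _ F]) (auto intro: le_less_trans)
  qed
  then show ?thesis
    unfolding infprod_def by (simp add: tendsto_Lim)
qed

lemma infprod_nonneg_le_1: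
  fixes f :: "'i \<Rightarrow> real"
  assumes "\<And>k. k \<in> A \<Longrightarrow> 0 \<le> f k \<and> f k \<le> 1"
  shows "0 \<le> infprod f A" "infprod f A \<le> 1"
proof -
  have lim: "(prod f \<longlongrightarrow> infprod f A) (finite_subsets_at_top A)"
    using assms by (rule infprod_tendsto)
  show "0 \<le> infprod f A"
    by (rule tendsto_lowerbound[OF lim])
      (use assms in \<open>auto intro!: eventually_finite_subsets_at_top_weakI prod_nonneg\<close>)
  show "infprod f A \<le> 1"
    by (rule tendsto_upperbound[OF lim])
      (use assms in \<open>auto intro!: eventually_finite_subsets_at_top_weakI prod_le_1\<close>)
qed

lemma borel_measurable_infprod:
  fixes f :: "'i \<Rightarrow> 'a \<Rightarrow> real"
  assumes A: "countable A" and f: "\<And>k. k \<in> A \<Longrightarrow> f k \<in> borel_measurable M"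
    and bnd: "\<And>k x. k \<in> A \<Longrightarrow> 0 \<le> f k x \<and> f k x \<le> 1"
  shows "(\<lambda>x. infprod (\<lambda>k. f k x) A) \<in> borel_measurable M"
proof -
  obtain E where E: "filterlim E (finite_subsets_at_top A) sequentially"
      "\<And>n. finite (E n)" "\<And>n. E n \<subseteq> A"
    by (rule countable_exhaustion[OF A], rule that)
  show ?thesis
  proof (rule borel_measurable_LIMSEQ_real)
    show "(\<lambda>n. \<Prod>k\<in>E n. f k x) \<longlonglongrightarrow> infprod (\<lambda>k. f k x) A" for x
      by (rule filterlim_compose[OF infprod_tendsto[OF bnd] E(1)])
    show "(\<lambda>x. \<Prod>k\<in>E n. f k x) \<in> borel_measurable M" for n
      using E f by (intro borel_measurable_prod) auto
  qed
qed

text \<open>Serves two purposes: conditioning the probability space on the void event, and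
  integrating against the uniform law on the remaining part of the cell.\<close>

lemma integral_uniform_measure:
  fixes f :: "'a \<Rightarrow> real"
  assumes A: "A \<in> sets M" "0 < emeasure M A" "emeasure M A < \<infinity>" and f: "f \<in> borel_measurable M"
  shows "(\<integral>x. f x \<partial>uniform_measure M A) = (\<integral>x. indicator A x * f x \<partial>M) / measure M A"
proof -
  have pos: "0 < measure M A"
    using A by (simp add: measure_def enn2real_positive_iff)
  have "indicator A x / emeasure M A = ennreal (indicator A x / measure M A)" for x
    using A pos by (cases "x \<in> A") (simp_all add: emeasure_eq_ennreal_measure divide_ennreal flip: ennreal_1)
  then have "uniform_measure M A = density M (\<lambda>x. ennreal (indicator A x / measure M A))"
    unfolding uniform_measure_def by simp
  then have "(\<integral>x. f x \<partial>uniform_measure M A) = (\<integral>x. indicator A x / measure M A * f x \<partial>M)"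
    using A f pos by (simp add: integral_real_density)
  also have "\<dots> = (\<integral>x. (indicator A x * f x) / measure M A \<partial>M)" by simp
  finally show ?thesis by simp
qed

subsection \<open>Expectations under independence\<close>

text \<open>Multiplying the density of rate 1 by \<open>exp (- (t * x))\<close> gives
  \<open>1 / (1 + t)\<close> times the density of rate \<open>1 + t\<close>, which has total mass
  1.\<close>

lemma (in prob_space) exponential_laplace:
  assumes D: "distributed M lborel X (exponential_density 1)" and t: "0 \<le> t"
  shows "expectation (\<lambda>\<omega>. exp (- (t * X \<omega>))) = 1 / (1 + t)"
proof -
  have "expectation (\<lambda>\<omega>. exp (- (t * X \<omega>))) = (\<integral>x. exponential_density 1 x * exp (- (t * x)) \<partial>lborel)"
    by (rule distributed_integral[OF D, symmetric]) (auto simp: exponential_density_nonneg)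
  also have "\<dots> = (\<integral>x. 1 / (1 + t) * exponential_density (1 + t) x \<partial>lborel)"
  proof (intro Bochner_Integration.integral_cong refl)
    fix x
    have "exp (- x) * exp (- (t * x)) = exp (- x * (1 + t))"
      by (simp add: algebra_simps flip: exp_add)
    then show "exponential_density 1 x * exp (- (t * x)) = 1 / (1 + t) * exponential_density (1 + t) x"
      using t by (simp add: exponential_density_def)
  qed
  also have "\<dots> = 1 / (1 + t) * (\<integral>x. exponential_density (1 + t) x \<partial>lborel)"
    by simp
  also have "(\<integral>x. exponential_density (1 + t) x \<partial>lborel) = 1"
  proof -
    interpret E: prob_space "density lborel (exponential_density (1 + t))"
      using t by (intro prob_space_exponential_density) simp
    have "(\<integral>x. 1 \<partial>density lborel (exponential_density (1 + t))) = (1::real)"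
      using E.prob_space by simp
    then show ?thesis
      using t by (subst (asm) integral_real_density) (auto simp: exponential_density_nonneg)
  qed
  finally show ?thesis by simp
qed

text \<open>Product measures are determined by measurable rectangles, and on these the claim is
  independence of the two preimages.\<close>

lemma (in prob_space) distr_pair_indep_set:
  assumes X: "X \<in> M \<rightarrow>\<^sub>M S" and Y: "Y \<in> M \<rightarrow>\<^sub>M T"
    and ind: "indep_set (sets (vimage_algebra (space M) X S)) (sets (vimage_algebra (space M) Y T))"
  shows "distr M S X \<Otimes>\<^sub>M distr M T Y = distr M (S \<Otimes>\<^sub>M T) (\<lambda>\<omega>. (X \<omega>, Y \<omega>))"
proof (rule pair_measure_eqI)
  interpret DX: prob_space "distr M S X" using X by (rule prob_space_distr)
  interpret DY: prob_space "distr M T Y" using Y by (rule prob_space_distr)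
  show "sigma_finite_measure (distr M S X)" "sigma_finite_measure (distr M T Y)" by unfold_locales
  show "sets (distr M S X \<Otimes>\<^sub>M distr M T Y) = sets (distr M (S \<Otimes>\<^sub>M T) (\<lambda>\<omega>. (X \<omega>, Y \<omega>)))"
    by (simp cong: sets_pair_measure_cong)
  fix A B assume "A \<in> sets (distr M S X)" "B \<in> sets (distr M T Y)"
  then have A: "A \<in> sets S" and B: "B \<in> sets T" by auto
  have "prob ((X -` A \<inter> space M) \<inter> (Y -` B \<inter> space M)) = prob (X -` A \<inter> space M) * prob (Y -` B \<inter> space M)"
    using A B by (intro indep_setD[OF ind] in_vimage_algebra)
  moreover have "(\<lambda>\<omega>. (X \<omega>, Y \<omega>)) -` (A \<times> B) \<inter> space M = (X -` A \<inter> space M) \<inter> (Y -` B \<inter> space M)"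
    by auto
  ultimately show "emeasure (distr M S X) A * emeasure (distr M T Y) B
      = emeasure (distr M (S \<Otimes>\<^sub>M T) (\<lambda>\<omega>. (X \<omega>, Y \<omega>))) (A \<times> B)"
    using A B X Y by (simp add: emeasure_distr emeasure_eq_measure ennreal_mult)
qed

text \<open>Fubini for the product law: \<open>X\<close> may be frozen at \<open>x\<close> while
  averaging over \<open>Y\<close>. The inner average need only be known for almost every
  \<open>x\<close>, since the Laplace formula will be available only for shifts in the closed
  cell.\<close>

lemma (in prob_space) expectation_indep_set:
  fixes f :: "'b \<Rightarrow> 'c \<Rightarrow> real"
  assumes X: "X \<in> M \<rightarrow>\<^sub>M S" and Y: "Y \<in> M \<rightarrow>\<^sub>M T"
    and ind: "indep_set (sets (vimage_algebra (space M) X S)) (sets (vimage_algebra (space M) Y T))"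
    and f: "(\<lambda>(x, y). f x y) \<in> borel_measurable (S \<Otimes>\<^sub>M T)"
    and int: "integrable M (\<lambda>\<omega>. f (X \<omega>) (Y \<omega>))"
    and g: "g \<in> borel_measurable S" "AE x in distr M S X. expectation (\<lambda>\<omega>. f x (Y \<omega>)) = g x"
  shows "expectation (\<lambda>\<omega>. f (X \<omega>) (Y \<omega>)) = expectation (\<lambda>\<omega>. g (X \<omega>))"
proof -
  interpret DX: prob_space "distr M S X" using X by (rule prob_space_distr)
  interpret DY: prob_space "distr M T Y" using Y by (rule prob_space_distr)
  interpret P: pair_prob_space "distr M S X" "distr M T Y" ..
  have "expectation (\<lambda>\<omega>. f (X \<omega>) (Y \<omega>))
      = (\<integral>z. (\<lambda>(x, y). f x y) z \<partial>distr M (S \<Otimes>\<^sub>M T) (\<lambda>\<omega>. (X \<omega>, Y \<omega>)))"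
    using X Y f by (subst integral_distr) auto
  also have "distr M (S \<Otimes>\<^sub>M T) (\<lambda>\<omega>. (X \<omega>, Y \<omega>)) = distr M S X \<Otimes>\<^sub>M distr M T Y"
    using distr_pair_indep_set[OF X Y ind] by simp
  also have "(\<integral>z. (\<lambda>(x, y). f x y) z \<partial>(distr M S X \<Otimes>\<^sub>M distr M T Y))
      = (\<integral>x. (\<integral>y. f x y \<partial>distr M T Y) \<partial>distr M S X)"
  proof (subst P.integral_fst)
    show "integrable (distr M S X \<Otimes>\<^sub>M distr M T Y) (\<lambda>(x, y). f x y)"
      using X Y f int unfolding distr_pair_indep_set[OF X Y ind]
      by (subst integrable_distr_eq) auto
  qed simp
  also have "\<dots> = (\<integral>x. g x \<partial>distr M S X)"
  proof (rule integral_cong_AE)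
    show "(\<lambda>x. \<integral>y. f x y \<partial>distr M T Y) \<in> borel_measurable (distr M S X)"
      using f by (intro DY.borel_measurable_lebesgue_integral) simp
    have "(\<integral>y. f x y \<partial>distr M T Y) = expectation (\<lambda>\<omega>. f x (Y \<omega>))" if "x \<in> space S" for x
      using measurable_compose[OF measurable_Pair1'[OF that, of T] f] Y
      by (subst integral_distr) auto
    with g(2) AE_space[of "distr M S X"]
    show "AE x in distr M S X. (\<integral>y. f x y \<partial>distr M T Y) = g x"
      by (auto elim!: eventually_mono[OF eventually_conj])
  qed (use g in auto)
  also have "\<dots> = expectation (\<lambda>\<omega>. g (X \<omega>))"
    using X g by (subst integral_distr) auto
  finally show ?thesis .
qed

subsection \<open>Lattice sums\<close>

text \<open>The nonnegative and the negative integers each reduce to a shifted p-series.\<close>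

lemma summable_on_int_powr:
  fixes \<beta> :: real
  assumes "\<beta> > 1"
  shows "(\<lambda>z::int. (1 + \<bar>of_int z\<bar>) powr - \<beta>) summable_on UNIV"
proof -
  have nat: "(\<lambda>n::nat. (1 + real n) powr - \<beta>) summable_on UNIV"
  proof -
    have "summable (\<lambda>n. real n powr - \<beta>)" using assms by (simp add: summable_real_powr_iff)
    then have "summable (\<lambda>n. real (Suc n) powr - \<beta>)" by (subst summable_Suc_iff)
    then have "summable (\<lambda>n. (1 + real n) powr - \<beta>)" by (simp add: add.commute)
    then show ?thesis by (intro summable_nonneg_imp_summable_on) auto
  qed
  have "(\<lambda>z::int. (1 + \<bar>of_int z\<bar>) powr - \<beta>) summable_on range int \<union> (- range int)"
  proof (rule summable_on_Un_disjoint)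
    show "(\<lambda>z::int. (1 + \<bar>of_int z\<bar>) powr - \<beta>) summable_on range int"
      using nat by (subst summable_on_reindex) (auto simp: o_def)
    have "(\<lambda>z::int. (1 + \<bar>of_int z\<bar>) powr - \<beta>) summable_on range (\<lambda>n. - int n)"
      using nat by (subst summable_on_reindex) (auto simp: o_def inj_on_def)
    moreover have "- range int \<subseteq> range (\<lambda>n. - int n)"
    proof
      fix z assume "z \<in> - range int"
      then have "z < 0" using nonneg_int_cases[of z] by fastforce
      then have "z = - int (nat (- z))" by simp
      then show "z \<in> range (\<lambda>n. - int n)" by blast
    qed
    ultimately show "(\<lambda>z::int. (1 + \<bar>of_int z\<bar>) powr - \<beta>) summable_on - range int"
      by (rule summable_on_subset_banach)
  qed simp
  then show ?thesis by simp
qed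

lemma summable_on_int_pair_powr:
  fixes \<beta> :: real
  assumes "\<beta> > 1"
  shows "(\<lambda>z::int \<times> int. ((1 + \<bar>of_int (fst z)\<bar>) * (1 + \<bar>of_int (snd z)\<bar>)) powr - \<beta>) summable_on UNIV"
proof -
  let ?g = "\<lambda>z::int. (1 + \<bar>of_int z\<bar> :: real) powr - \<beta>"
  have "(\<lambda>z. ?g (fst z) * ?g (snd z)) summable_on (UNIV \<times> UNIV)"
  proof (rule summable_on_SigmaI)
    show "((\<lambda>y. ?g (fst (x, y)) * ?g (snd (x, y))) has_sum (?g x * infsum ?g UNIV)) UNIV" for x
      using has_sum_cmult_right[OF has_sum_infsum[OF summable_on_int_powr[OF assms]], of "?g x"] by simp
    show "(\<lambda>x. ?g x * infsum ?g UNIV) summable_on UNIV"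
      by (intro summable_on_cmult_left summable_on_int_powr assms)
  qed auto
  then show ?thesis by (simp add: powr_mult)
qed

text \<open>
  The geometric mean of the coordinates, instead of their maximum, makes the bound on the lattice
  sum factor into one-dimensional sums.
\<close>

lemma norm_add_lattice_point_ge:
  assumes s: "0 < s" and u: "u \<in> closed_cell s" and z: "z \<noteq> (0, 0)"
  shows "s / 4 * sqrt ((1 + \<bar>of_int (fst z)\<bar>) * (1 + \<bar>of_int (snd z)\<bar>)) \<le> norm (u + lattice_point s z)"
proof -
  obtain a b i j where [simp]: "u = (a, b)" "z = (i, j)" by fastforce
  have ab: "\<bar>a\<bar> \<le> s / 2" "\<bar>b\<bar> \<le> s / 2" using u by (auto simp: closed_cell_def)
  \<comment> \<open>A coordinate of the shift is at most \<open>s / 2\<close> in absolute value, so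
    it can bring a lattice coordinate closer to 0 by at most half a step.\<close>
  have coord: "s * (real_of_int \<bar>k\<bar> - 1 / 2) \<le> norm (u + lattice_point s z)"
    if "(c, k) = (a, i) \<or> (c, k) = (b, j)" for c k
  proof -
    have "s * real_of_int \<bar>k\<bar> - \<bar>c\<bar> \<le> \<bar>c + s * of_int k\<bar>"
      using s abs_triangle_ineq2_sym[of "s * of_int k" "- c"] by (simp add: abs_mult algebra_simps)
    also have "\<bar>c + s * of_int k\<bar> \<le> norm (u + lattice_point s z)"
      using that norm_fst_le[of "a + s * of_int i" "b + s * of_int j"]
        norm_snd_le[of "b + s * of_int j" "a + s * of_int i"]
      by (auto simp: lattice_point_def)
    finally show ?thesis using that ab by (auto simp: algebra_simps)
  qed
  define m where "m = max \<bar>i\<bar> \<bar>j\<bar>"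
  have m: "1 \<le> m" using z by (auto simp: m_def)
  have "sqrt ((1 + \<bar>of_int i\<bar>) * (1 + \<bar>of_int j\<bar>)) \<le> sqrt ((1 + of_int m)\<^sup>2 :: real)"
    unfolding power2_eq_square
    by (intro real_sqrt_le_mono mult_mono) (auto simp: m_def)
  also have "\<dots> = 1 + of_int m" using m by (simp add: real_sqrt_abs)
  \<comment> \<open>Equivalent to \<open>1 \<le> m\<close>, with equality at 1; this is where the
    constant 4 in the bound comes from.\<close>
  also have "\<dots> \<le> 4 * (of_int m - 1 / 2)" using m by simp
  finally have "s / 4 * sqrt ((1 + \<bar>of_int i\<bar>) * (1 + \<bar>of_int j\<bar>)) \<le> s / 4 * (4 * (of_int m - 1 / 2))"
    using s by (intro mult_left_mono) auto
  also have "\<dots> \<le> norm (u + lattice_point s z)"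
    using coord[of a i] coord[of b j] by (cases "\<bar>i\<bar> \<le> \<bar>j\<bar>") (simp_all add: m_def max_def algebra_simps)
  finally show ?thesis by simp
qed

lemma summable_on_lattice_powr:
  assumes s: "0 < s" and u: "u \<in> closed_cell s" and \<alpha>: "\<alpha> > 2"
  shows "(\<lambda>z. norm (u + lattice_point s z) powr - \<alpha>) summable_on A"
proof -
  let ?n = "\<lambda>z :: int \<times> int. (1 + \<bar>of_int (fst z)\<bar>) * (1 + \<bar>of_int (snd z)\<bar>) :: real"
  have scale: "(s / 4 * sqrt x) powr - \<alpha> = (s / 4) powr - \<alpha> * x powr - (\<alpha> / 2)" if "0 < x" for x
  proof -
    have "(s / 4 * sqrt x) powr - \<alpha> = (s / 4) powr - \<alpha> * sqrt x powr - \<alpha>"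
      by (rule powr_mult)
    also have "sqrt x powr - \<alpha> = x powr - (\<alpha> / 2)"
      using that by (simp add: powr_powr flip: powr_half_sqrt)
    finally show ?thesis .
  qed
  have "(\<lambda>z. norm (u + lattice_point s z) powr - \<alpha>) summable_on - {(0, 0)}"
  proof (rule summable_on_comparison_test)
    show "(\<lambda>z. (s / 4) powr - \<alpha> * ?n z powr - (\<alpha> / 2)) summable_on - {(0, 0)}"
      using \<alpha> by (intro summable_on_cmult_right summable_on_subset_banach[OF summable_on_int_pair_powr]) auto
  next
    fix z :: "int \<times> int" assume "z \<in> - {(0, 0)}"
    have n: "0 < ?n z" by (intro mult_pos_pos) auto
    have "norm (u + lattice_point s z) powr - \<alpha> \<le> (s / 4 * sqrt (?n z)) powr - \<alpha>"
      using s u \<alpha> n \<open>z \<in> - {(0, 0)}\<close>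
      by (intro powr_mono2' norm_add_lattice_point_ge mult_pos_pos) auto
    also have "\<dots> = (s / 4) powr - \<alpha> * ?n z powr - (\<alpha> / 2)"
      using scale[OF n] .
    finally show "norm (u + lattice_point s z) powr - \<alpha> \<le> (s / 4) powr - \<alpha> * ?n z powr - (\<alpha> / 2)" .
  qed auto
  then have "(\<lambda>z. norm (u + lattice_point s z) powr - \<alpha>) summable_on (- {(0, 0)} \<union> {(0, 0)})"
    by (intro summable_on_Un_disjoint) auto
  then show ?thesis by (rule summable_on_subset_banach) auto
qed

section \<open>Geometry of the grid and its indexing by the lattice\<close>

text \<open>A nonzero lattice step moves a coordinate by at least \<open>s\<close>, hence leaves it
  at distance at least \<open>s / 2\<close> from 0. So a shift in the cell is a nearest grid point
  to the origin, with ties possible on the boundary.\<close>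

lemma norm_le_norm_lattice_point_add:
  assumes s: "0 < s" and u: "u \<in> closed_cell s"
  shows "norm u \<le> norm (lattice_point s z + u)"
proof -
  have coord: "c\<^sup>2 \<le> (s * of_int k + c)\<^sup>2" if "\<bar>c\<bar> \<le> s / 2" for c :: real and k :: int
  proof (cases "k = 0")
    case False
    then have "s * 1 \<le> s * real_of_int \<bar>k\<bar>"
      using s by (intro mult_left_mono) linarith+
    moreover have "s * real_of_int \<bar>k\<bar> - \<bar>c\<bar> \<le> \<bar>s * of_int k + c\<bar>"
      using s abs_triangle_ineq2_sym[of "s * of_int k" "- c"] by (simp add: abs_mult algebra_simps)
    ultimately show ?thesis using that by (intro abs_le_square_iff[THEN iffD1]) linarith
  qed simp
  show ?thesis
    using u coord[of "fst u" "fst z"] coord[of "snd u" "snd z"]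
    by (auto simp: closed_cell_def lattice_point_def norm_Pair intro!: add_mono)
qed

lemma lattice_point_inj: "s \<noteq> 0 \<Longrightarrow> lattice_point s k = lattice_point s l \<longleftrightarrow> k = l"
  by (auto simp: lattice_point_def prod_eq_iff)

text \<open>Passing from points to indices removes the random set from the summation range: the
  shift then enters only through the path losses, and the marks are the independent family
  itself.\<close>

lemma interference_lattice:
  assumes s: "s \<noteq> 0"
  shows "interference p \<alpha> (grid_mark s u h) ((\<lambda>k. lattice_point s k + u) ` A)
    = (\<Sum>\<^sub>\<infinity>k\<in>A. p * h k * norm (u + lattice_point s k) powr - \<alpha>)"
proof -
  have "grid_mark s u h (lattice_point s k + u) = h k" for k
    using s by (simp add: grid_mark_def lattice_point_inj)
  moreover have "inj_on (\<lambda>k. lattice_point s k + u) A"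
    using s by (simp add: inj_on_def lattice_point_inj)
  ultimately show ?thesis
    unfolding interference_def by (subst infsum_reindex) (auto simp: o_def add.commute)
qed

lemma shifted_grid_minus:
  assumes s: "s \<noteq> 0"
  shows "shifted_grid s u - {u} = (\<lambda>k. lattice_point s k + u) ` (UNIV - {(0, 0)})"
proof -
  have "lattice_point s k = 0 \<longleftrightarrow> k = (0, 0)" for k
    using s by (auto simp: lattice_point_def prod_eq_iff zero_prod_def)
  then show ?thesis by (auto simp: shifted_grid_def)
qed

lemma (in prob_space) exponential_AE_nonneg:
  assumes "distributed M lborel X (exponential_density 1)"
  shows "AE \<omega> in M. 0 \<le> X \<omega>"
  by (subst distributed_AE2[OF assms]) (auto simp: exponential_density_def)

subsection \<open>Series of independent exponential variables\<close>

lemma inverse_one_plus_bounds: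
  fixes x :: real
  assumes "0 \<le> x"
  shows "0 \<le> 1 / (1 + x) \<and> 1 / (1 + x) \<le> 1"
  using assms by simp

text \<open>Summability of reals is absolute, so it is integrability for counting measure; this
  opens series to Tonelli's theorem.\<close>

lemma summable_on_real_iff_integrable:
  fixes f :: "'i \<Rightarrow> real"
  shows "f summable_on A \<longleftrightarrow> integrable (count_space A) f"
  by (subst summable_on_iff_abs_summable_on_real) (simp only: abs_summable_equivalent abs_summable_on_def)

text \<open>Each mark is almost surely nonnegative with mean 1, so by Tonelli the expected sum of
  absolute values equals the finite sum of the coefficients. A finite expectation forces finiteness
  almost everywhere.\<close>

lemma (in prob_space) exponential_series_AE_summable:
  assumes A: "countable A"
    and H: "\<And>k. k \<in> A \<Longrightarrow> distributed M lborel (H k) (exponential_density 1)"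
    and a: "\<And>k. k \<in> A \<Longrightarrow> 0 \<le> a k" "a summable_on A"
  shows "AE \<omega> in M. (\<lambda>k. a k * H k \<omega>) summable_on A"
proof -
  have H_meas [measurable]: "k \<in> A \<Longrightarrow> H k \<in> borel_measurable M" for k
    using distributed_measurable[OF H] by simp
  have H_int: "(\<integral>\<^sup>+\<omega>. ennreal (norm (H k \<omega>)) \<partial>M) = 1" if k: "k \<in> A" for k
  proof -
    have E: "expectation (H k) = 1"
      using exponential_distributed_expectation[OF _ H[OF k]] by simp
    \<comment> \<open>A non-integrable function would have Bochner integral 0, not 1.\<close>
    then have "integrable M (H k)"
      using not_integrable_integral_eq by fastforce
    moreover have "expectation (\<lambda>\<omega>. norm (H k \<omega>)) = expectation (H k)"
      using exponential_AE_nonneg[OF H[OF k]] k by (intro integral_cong_AE) auto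
    ultimately show ?thesis
      using E by (subst nn_integral_eq_integral) auto
  qed
  have "(\<integral>\<^sup>+\<omega>. (\<integral>\<^sup>+k. ennreal (norm (a k * H k \<omega>)) \<partial>count_space A) \<partial>M)
      = (\<integral>\<^sup>+k. (\<integral>\<^sup>+\<omega>. ennreal (norm (a k * H k \<omega>)) \<partial>M) \<partial>count_space A)"
    using A by (intro nn_integral_count_space_nn_integral) measurable
  also have "\<dots> = (\<integral>\<^sup>+k. ennreal (norm (a k)) \<partial>count_space A)"
    by (intro nn_integral_cong) (simp add: abs_mult ennreal_mult nn_integral_cmult H_int[simplified])
  also have "\<dots> < \<infinity>"
    using a(2) unfolding summable_on_real_iff_integrable
    by (simp add: integrable_iff_bounded)
  finally have fin: "(\<integral>\<^sup>+\<omega>. (\<integral>\<^sup>+k. ennreal (norm (a k * H k \<omega>)) \<partial>count_space A) \<partial>M) < \<infinity>" .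
  interpret C: sigma_finite_measure "count_space A"
    by (rule sigma_finite_measure_count_space_countable[OF A])
  have "(\<lambda>(\<omega>, k). ennreal (norm (a k * H k \<omega>))) \<in> borel_measurable (M \<Otimes>\<^sub>M count_space A)"
    by (subst measurable_pair_swap_iff, rule measurable_pair_measure_countable1[OF A]) auto
  then have "(\<lambda>\<omega>. \<integral>\<^sup>+k. ennreal (norm (a k * H k \<omega>)) \<partial>count_space A) \<in> borel_measurable M"
    by (rule C.borel_measurable_nn_integral)
  then have "AE \<omega> in M. (\<integral>\<^sup>+k. ennreal (norm (a k * H k \<omega>)) \<partial>count_space A) \<noteq> \<infinity>"
    using fin by (intro nn_integral_PInf_AE) auto
  then show ?thesis
    unfolding summable_on_real_iff_integrable
    by eventually_elim (simp add: integrable_iff_bounded top.not_eq_extremum)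
qed

text \<open>Finite partial sums factor by independence into the exponential transforms. Along the
  exhausting sequence the left side converges by dominated convergence and the right side to
  \<open>infprod\<close>, so the limits agree.\<close>

lemma (in prob_space) exponential_series_laplace:
  assumes A: "countable A" and ind: "indep_vars (\<lambda>_. borel) H A"
    and H: "\<And>k. k \<in> A \<Longrightarrow> distributed M lborel (H k) (exponential_density 1)"
    and a: "\<And>k. k \<in> A \<Longrightarrow> 0 \<le> a k" "a summable_on A"
  shows "expectation (\<lambda>\<omega>. exp (- (\<Sum>\<^sub>\<infinity>k\<in>A. a k * H k \<omega>))) = infprod (\<lambda>k. 1 / (1 + a k)) A"
proof -
  obtain E where E: "filterlim E (finite_subsets_at_top A) sequentially"
      "\<And>n. finite (E n)" "\<And>n. E n \<subseteq> A"
    by (rule countable_exhaustion[OF A], rule that)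
  have H_meas [measurable]: "k \<in> A \<Longrightarrow> H k \<in> borel_measurable M" for k
    using distributed_measurable[OF H] by simp
  have sum_meas [measurable]: "(\<lambda>\<omega>. \<Sum>k\<in>E n. a k * H k \<omega>) \<in> borel_measurable M" for n
    by (intro borel_measurable_sum borel_measurable_times H_meas subsetD[OF E(3)]) auto
  have infsum_meas [measurable]: "(\<lambda>\<omega>. \<Sum>\<^sub>\<infinity>k\<in>A. a k * H k \<omega>) \<in> borel_measurable M"
    using A by (intro borel_measurable_infsum) auto
  have nonneg: "AE \<omega> in M. \<forall>k\<in>A. 0 \<le> H k \<omega>"
    using A H exponential_AE_nonneg by (intro AE_ball_countable') auto
  have summable: "AE \<omega> in M. (\<lambda>k. a k * H k \<omega>) summable_on A"
    using A H a by (rule exponential_series_AE_summable)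
  have "(\<lambda>n. expectation (\<lambda>\<omega>. exp (- (\<Sum>k\<in>E n. a k * H k \<omega>))))
      \<longlonglongrightarrow> expectation (\<lambda>\<omega>. exp (- (\<Sum>\<^sub>\<infinity>k\<in>A. a k * H k \<omega>)))"
  \<comment> \<open>The constant bound 1 comes from nonnegativity of the marks and the coefficients,
    both holding outside one null set for all indices.\<close>
  proof (rule integral_dominated_convergence[where w="\<lambda>_. 1"])
    show "AE \<omega> in M. (\<lambda>n. exp (- (\<Sum>k\<in>E n. a k * H k \<omega>))) \<longlonglongrightarrow> exp (- (\<Sum>\<^sub>\<infinity>k\<in>A. a k * H k \<omega>))"
      using summable
    proof eventually_elim
      case (elim \<omega>)
      show ?case
        by (intro tendsto_exp tendsto_minus filterlim_compose[OF infsum_tendsto[OF elim] E(1)])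
    qed
    show "AE \<omega> in M. norm (exp (- (\<Sum>k\<in>E n. a k * H k \<omega>))) \<le> 1" for n
      using nonneg
    proof eventually_elim
      case (elim \<omega>)
      then have "0 \<le> (\<Sum>k\<in>E n. a k * H k \<omega>)"
        using a(1) by (intro sum_nonneg mult_nonneg_nonneg) (auto dest: subsetD[OF E(3)])
      then show ?case by simp
    qed
  qed auto
  moreover have "expectation (\<lambda>\<omega>. exp (- (\<Sum>k\<in>E n. a k * H k \<omega>))) = (\<Prod>k\<in>E n. 1 / (1 + a k))" for n
  proof -
    have ind': "indep_vars (\<lambda>_. borel) (\<lambda>k \<omega>. exp (- (a k * H k \<omega>))) (E n)"
      by (rule indep_vars_compose2[OF indep_vars_subset[OF ind E(3)]]) simp
    have int: "integrable M (\<lambda>\<omega>. exp (- (a k * H k \<omega>)))" if "k \<in> E n" for k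
    proof (rule integrable_const_bound[where B=1])
      have "k \<in> A" using that by (rule subsetD[OF E(3)])
      then show "AE \<omega> in M. norm (exp (- (a k * H k \<omega>))) \<le> 1"
        using nonneg a by (auto elim!: eventually_mono)
      show "(\<lambda>\<omega>. exp (- (a k * H k \<omega>))) \<in> borel_measurable M"
        using \<open>k \<in> A\<close> by measurable
    qed
    have "expectation (\<lambda>\<omega>. exp (- (\<Sum>k\<in>E n. a k * H k \<omega>)))
        = expectation (\<lambda>\<omega>. \<Prod>k\<in>E n. exp (- (a k * H k \<omega>)))"
      using E by (simp add: exp_sum flip: sum_negf)
    also have "\<dots> = (\<Prod>k\<in>E n. expectation (\<lambda>\<omega>. exp (- (a k * H k \<omega>))))"
      by (rule indep_vars_lebesgue_integral[OF E(2) ind' int])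
    also have "\<dots> = (\<Prod>k\<in>E n. 1 / (1 + a k))"
      using a(1) H by (intro prod.cong exponential_laplace refl) (auto dest: subsetD[OF E(3)])
    finally show ?thesis .
  qed
  moreover have "(\<lambda>n. \<Prod>k\<in>E n. 1 / (1 + a k)) \<longlonglongrightarrow> infprod (\<lambda>k. 1 / (1 + a k)) A"
    by (rule filterlim_compose[OF infprod_tendsto E(1)]) (intro inverse_one_plus_bounds a(1))
  ultimately show ?thesis
    using LIMSEQ_unique by simp
qed

subsection \<open>Interference from a marked grid\<close>

lemma closed_cell_borel [measurable]: "closed_cell s \<in> sets borel"
  unfolding closed_cell_def by (intro borel_closed closed_Times closed_atLeastAtMost)

lemma open_cell_borel [measurable]: "open_cell s \<in> sets borel"
  unfolding open_cell_def by (intro borel_open open_Times open_greaterThanLessThan)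

lemma closed_cell_eq_cbox: "closed_cell s = cbox (- s / 2, - s / 2) (s / 2, s / 2)"
  by (simp add: closed_cell_def cbox_Pair_eq)

lemma open_cell_eq_box: "open_cell s = box (- s / 2, - s / 2) (s / 2, s / 2)"
  by (auto simp: open_cell_def box_def Basis_prod_def)

text \<open>The two cells differ by the boundary of a box, and closed and open boxes have equal
  volume. This reconciles the law of the shift, given on the closed cell, with the integral over the
  open one.\<close>

lemma AE_closed_cell_iff_open_cell: "AE u in lborel. u \<in> closed_cell s \<longleftrightarrow> u \<in> open_cell s"
proof (rule AE_I')
  let ?a = "(- s / 2, - s / 2)" and ?b = "(s / 2, s / 2)"
  have "emeasure lborel (cbox ?a ?b - box ?a ?b) = emeasure lborel (cbox ?a ?b) - emeasure lborel (box ?a ?b)"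
    by (rule emeasure_Diff) (auto simp: emeasure_lborel_box_eq box_subset_cbox)
  also have "\<dots> = 0"
    by (simp add: emeasure_lborel_box_eq emeasure_lborel_cbox_eq)
  finally show "cbox ?a ?b - box ?a ?b \<in> null_sets lborel"
    by (intro null_setsI) auto
  show "{u \<in> space lborel. \<not> (u \<in> closed_cell s \<longleftrightarrow> u \<in> open_cell s)} \<subseteq> cbox ?a ?b - box ?a ?b"
    unfolding closed_cell_eq_cbox open_cell_eq_box using box_subset_cbox by blast
qed

lemma borel_measurable_lattice_infprod:
  assumes "0 \<le> c"
  shows "(\<lambda>u. infprod (\<lambda>z. 1 / (1 + c * norm (u + lattice_point s z) powr - \<alpha>)) A) \<in> borel_measurable borel"
proof (rule borel_measurable_infprod)
  fix z u
  show "0 \<le> 1 / (1 + c * norm (u + lattice_point s z) powr - \<alpha>)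
      \<and> 1 / (1 + c * norm (u + lattice_point s z) powr - \<alpha>) \<le> 1"
    using assms by (intro inverse_one_plus_bounds) simp
qed auto

text \<open>Here the shift is merely a random point of the cell; its uniform law enters with the
  void conditioning.\<close>

locale marked_grid = prob_space +
  fixes U :: "'a \<Rightarrow> real \<times> real" and H :: "int \<times> int \<Rightarrow> 'a \<Rightarrow> real" and s p \<alpha> \<xi> :: real
  assumes s_pos: "0 < s" and p_pos: "0 < p" and \<alpha>: "\<alpha> > 2" and \<xi>_pos: "0 < \<xi>"
    and U_meas [measurable]: "U \<in> borel_measurable M"
    and U_cell: "AE \<omega> in M. U \<omega> \<in> closed_cell s"
    and H_exp: "\<And>k. distributed M lborel (H k) (exponential_density 1)"
    and H_indep: "indep_vars (\<lambda>_. borel) H UNIV"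
    and UH_indep: "indep_set (sets (vimage_algebra (space M) U borel))
        (sets (vimage_algebra (space M) (\<lambda>\<omega> k. H k \<omega>) (Pi\<^sub>M UNIV (\<lambda>_. borel))))"
begin

lemma H_meas [measurable]: "H k \<in> borel_measurable M"
  using distributed_measurable[OF H_exp] by simp

text \<open>The index set \<open>A\<close> lets the full grid and the grid without its serving
  station be treated together.\<close>

definition grid_interference :: "(int \<times> int) set \<Rightarrow> 'a \<Rightarrow> real" where
  "grid_interference A \<omega> =
     interference p \<alpha> (grid_mark s (U \<omega>) (\<lambda>k. H k \<omega>)) ((\<lambda>k. lattice_point s k + U \<omega>) ` A)"

lemma grid_interference_eq:
  "grid_interference A \<omega> = (\<Sum>\<^sub>\<infinity>k\<in>A. p * H k \<omega> * norm (U \<omega> + lattice_point s k) powr - \<alpha>)"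
  unfolding grid_interference_def using s_pos by (intro interference_lattice) simp

lemma borel_measurable_grid_interference [measurable]: "grid_interference A \<in> borel_measurable M"
  unfolding grid_interference_eq[abs_def] by (intro borel_measurable_infsum) auto

lemma integrable_exp_grid_interference: "integrable M (\<lambda>\<omega>. exp (- \<xi> * grid_interference A \<omega>))"
proof (rule integrable_const_bound[where B=1])
  have "AE \<omega> in M. \<forall>k. 0 \<le> H k \<omega>"
    by (subst AE_all_countable) (intro allI exponential_AE_nonneg H_exp)
  then show "AE \<omega> in M. norm (exp (- \<xi> * grid_interference A \<omega>)) \<le> 1"
  proof eventually_elim
    case (elim \<omega>)
    then have "0 \<le> grid_interference A \<omega>"
      unfolding grid_interference_eq using p_pos by (intro infsum_nonneg) auto
    then show ?case using \<xi>_pos by simp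
  qed
qed measurable

section \<open>Laplace transforms given the shift and under void conditioning\<close>

text \<open>Freezing the shift leaves a series of independent exponentials with known transform. The
  set \<open>B\<close> is arbitrary because it plays two parts: test set for the conditional
  expectation, and void event in the conditioned law.\<close>

lemma expectation_exp_grid_interference:
  assumes B [measurable]: "B \<in> sets borel"
  shows "expectation (\<lambda>\<omega>. indicator B (U \<omega>) * exp (- \<xi> * grid_interference A \<omega>))
    = expectation (\<lambda>\<omega>. indicator B (U \<omega>)
        * infprod (\<lambda>z. 1 / (1 + p * \<xi> * norm (U \<omega> + lattice_point s z) powr - \<alpha>)) A)"
proof -
  let ?f = "\<lambda>u h. indicator B u
      * exp (- \<xi> * (\<Sum>\<^sub>\<infinity>k\<in>A. p * h k * norm (u + lattice_point s k) powr - \<alpha>)) :: real"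
  let ?g = "\<lambda>u. indicator B u
      * infprod (\<lambda>z. 1 / (1 + p * \<xi> * norm (u + lattice_point s z) powr - \<alpha>)) A :: real"
  have "expectation (\<lambda>\<omega>. ?f (U \<omega>) (\<lambda>k. H k \<omega>)) = expectation (\<lambda>\<omega>. ?g (U \<omega>))"
  proof (rule expectation_indep_set[OF _ _ UH_indep])
    show "(\<lambda>\<omega> k. H k \<omega>) \<in> M \<rightarrow>\<^sub>M Pi\<^sub>M UNIV (\<lambda>_. borel)"
      by (rule measurable_PiM_single') (auto simp: space_PiM)
    have "(\<lambda>x. \<Sum>\<^sub>\<infinity>k\<in>A. p * snd x k * norm (fst x + lattice_point s k) powr - \<alpha>)
        \<in> borel_measurable (borel \<Otimes>\<^sub>M Pi\<^sub>M UNIV (\<lambda>_. borel))"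
      by (rule borel_measurable_infsum) auto
    then show "(\<lambda>(u, h). ?f u h) \<in> borel_measurable (borel \<Otimes>\<^sub>M Pi\<^sub>M UNIV (\<lambda>_. borel))"
      unfolding case_prod_beta by measurable
    have "integrable M (\<lambda>\<omega>. indicator B (U \<omega>) * exp (- \<xi> * grid_interference A \<omega>))"
      by (rule Bochner_Integration.integrable_bound[OF integrable_exp_grid_interference[of A]])
        (auto simp: indicator_def)
    then show "integrable M (\<lambda>\<omega>. ?f (U \<omega>) (\<lambda>k. H k \<omega>))"
      by (simp add: grid_interference_eq)
    show "?g \<in> borel_measurable borel"
      using p_pos \<xi>_pos by (intro borel_measurable_times borel_measurable_lattice_infprod) auto
    \<comment> \<open>Summability of the path losses has been proved for shifts in the closed cell,
      which carries the law of \<open>U\<close>.\<close>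
    have "AE u in distr M borel U. u \<in> closed_cell s"
      using U_cell by (subst AE_distr_iff) auto
    then show "AE u in distr M borel U. expectation (\<lambda>\<omega>. ?f u (\<lambda>k. H k \<omega>)) = ?g u"
    proof eventually_elim
      case (elim u)
      let ?a = "\<lambda>k. p * \<xi> * norm (u + lattice_point s k) powr - \<alpha>"
      have "\<xi> * (\<Sum>\<^sub>\<infinity>k\<in>A. p * H k \<omega> * norm (u + lattice_point s k) powr - \<alpha>)
          = (\<Sum>\<^sub>\<infinity>k\<in>A. ?a k * H k \<omega>)" for \<omega>
        by (subst infsum_cmult_right'[symmetric]) (simp add: ac_simps)
      then have "expectation (\<lambda>\<omega>. ?f u (\<lambda>k. H k \<omega>))
          = indicator B u * expectation (\<lambda>\<omega>. exp (- (\<Sum>\<^sub>\<infinity>k\<in>A. ?a k * H k \<omega>)))"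
        by simp
      also have "expectation (\<lambda>\<omega>. exp (- (\<Sum>\<^sub>\<infinity>k\<in>A. ?a k * H k \<omega>))) = infprod (\<lambda>k. 1 / (1 + ?a k)) A"
      proof (rule exponential_series_laplace)
        show "indep_vars (\<lambda>_. borel) H A"
          using H_indep by (rule indep_vars_subset) simp
        show "?a summable_on A"
          by (intro summable_on_cmult_right summable_on_lattice_powr s_pos elim \<alpha>)
      qed (use H_exp p_pos \<xi>_pos in auto)
      finally show ?case .
    qed
  qed measurable
  then show ?thesis by (simp add: grid_interference_eq)
qed

text \<open>Every event of the sigma-algebra generated by \<open>U\<close> is a preimage of a Borel
  set, so the defining identity of the conditional expectation is the previous lemma. The product is
  a measurable function of \<open>U\<close>, as required.\<close>

lemma cond_laplace_grid_interference:
  "AE \<omega> in M. cond_laplace_transform M U (grid_interference A) \<xi> \<omega>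
    = infprod (\<lambda>z. 1 / (1 + p * \<xi> * norm (U \<omega> + lattice_point s z) powr - \<alpha>)) A"
proof -
  let ?F = "vimage_algebra (space M) U borel"
  let ?g = "\<lambda>u. infprod (\<lambda>z. 1 / (1 + p * \<xi> * norm (u + lattice_point s z) powr - \<alpha>)) A"
  have g [measurable]: "?g \<in> borel_measurable borel"
    using p_pos \<xi>_pos by (intro borel_measurable_lattice_infprod) auto
  have g_bounds: "0 \<le> ?g u" "?g u \<le> 1" for u
    using p_pos \<xi>_pos by (intro infprod_nonneg_le_1 inverse_one_plus_bounds; simp)+
  have F: "sets ?F = {U -` B \<inter> space M |B. B \<in> sets borel}"
    by (rule sets_vimage_algebra2) simp
  interpret finite_measure_subalgebra M ?F
    by unfold_locales (auto simp: subalgebra_def F)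
  have "AE \<omega> in M. real_cond_exp M ?F (\<lambda>\<omega>. exp (- \<xi> * grid_interference A \<omega>)) \<omega> = ?g (U \<omega>)"
  proof (rule real_cond_exp_charact)
    fix C assume "C \<in> sets ?F"
    then obtain B where B: "B \<in> sets borel" and C: "C = U -` B \<inter> space M"
      unfolding F by blast
    have "(\<integral>\<omega>\<in>C. h \<omega> \<partial>M) = expectation (\<lambda>\<omega>. indicator B (U \<omega>) * h \<omega>)" for h :: "'a \<Rightarrow> real"
      unfolding set_lebesgue_integral_def C
      by (intro Bochner_Integration.integral_cong) (auto simp: indicator_def)
    then show "(\<integral>\<omega>\<in>C. exp (- \<xi> * grid_interference A \<omega>) \<partial>M) = (\<integral>\<omega>\<in>C. ?g (U \<omega>) \<partial>M)"
      using expectation_exp_grid_interference[OF B, of A] by simp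
  next
    show "integrable M (\<lambda>\<omega>. ?g (U \<omega>))"
      by (rule integrable_const_bound[where B=1]) (use g_bounds in auto)
    show "(\<lambda>\<omega>. ?g (U \<omega>)) \<in> borel_measurable ?F"
      by (rule measurable_compose[OF measurable_vimage_algebra1 g]) simp
  qed (rule integrable_exp_grid_interference)
  then show ?thesis by (simp add: cond_laplace_transform_def)
qed

text \<open>Since the shift is nearest to the origin, the void event says that the shift itself
  avoids the ball. Both numerator and probability of the event then become integrals over
  \<open>D\<close> divided by the cell area, which cancels.\<close>

lemma void_laplace_grid_interference:
  fixes r :: real
  defines "D \<equiv> open_cell s - ball 0 r"
  assumes U: "distributed M lborel U (\<lambda>u. indicator (closed_cell s) u / measure lborel (closed_cell s))"
    and D_pos: "emeasure lborel D > 0"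
  shows "laplace_transform (void_conditioned M s U r) (grid_interference A) \<xi>
    = (LINT u:D|uniform_measure lborel D.
        infprod (\<lambda>z. 1 / (1 + p * \<xi> * norm (u + lattice_point s z) powr - \<alpha>)) A)"
proof -
  let ?c = "measure lborel (closed_cell s)"
  let ?g = "\<lambda>u. infprod (\<lambda>z. 1 / (1 + p * \<xi> * norm (u + lattice_point s z) powr - \<alpha>)) A"
  define B where "B = {u. \<forall>k. lattice_point s k + u \<notin> ball 0 r}"
  have g [measurable]: "?g \<in> borel_measurable borel"
    using p_pos \<xi>_pos by (intro borel_measurable_lattice_infprod) auto
  have D [measurable]: "D \<in> sets borel" unfolding D_def by measurable
  have "B = {u \<in> space borel. \<forall>k. r \<le> norm (lattice_point s k + u)}"
    by (auto simp: B_def not_less)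
  then have B_meas [measurable]: "B \<in> sets borel" by simp
  have cell_fin: "emeasure lborel (closed_cell s) < \<infinity>"
    by (simp add: closed_cell_eq_cbox emeasure_lborel_cbox_eq)
  have D_sub: "D \<subseteq> closed_cell s"
    by (auto simp: D_def open_cell_def closed_cell_def)
  then have D_fin: "emeasure lborel D < \<infinity>"
    using cell_fin emeasure_mono[of D "closed_cell s" lborel] by (simp add: le_less_trans)
  have D_meas_pos: "0 < measure lborel D"
    using D_pos D_fin by (simp add: measure_def enn2real_positive_iff)
  have c_pos: "0 < ?c"
    using D_meas_pos D_sub cell_fin
    by (intro less_le_trans[OF _ measure_mono_fmeasurable[of D "closed_cell s" lborel]])
      (auto simp: fmeasurable_def)
  \<comment> \<open>Inside the closed cell, index \<open>(0, 0)\<close> gives one direction and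
    minimality of the norm of the shift the other. Almost everywhere suffices because the cell
    boundary is null.\<close>
  have cell_B: "AE u in lborel. indicator (closed_cell s) u * indicator B u = (indicator D u :: real)"
    using AE_closed_cell_iff_open_cell[of s]
  proof eventually_elim
    case (elim u)
    have "u \<in> B \<longleftrightarrow> u \<notin> ball 0 r" if "u \<in> closed_cell s"
    proof
      have "lattice_point s (0, 0) = 0" by (simp add: lattice_point_def zero_prod_def)
      then show "u \<in> B \<Longrightarrow> u \<notin> ball 0 r"
        unfolding B_def by (metis (mono_tags, lifting) add_0 mem_Collect_eq)
      show "u \<notin> ball 0 r \<Longrightarrow> u \<in> B"
        unfolding B_def using norm_le_norm_lattice_point_add[OF s_pos that]
        by (auto simp: not_less intro: order_trans)
    qed
    with elim show ?case by (auto simp: D_def indicator_def)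
  qed
  \<comment> \<open>Used with \<open>h\<close> equal to 1 for the probability of the void event and
    with \<open>?g\<close> for the numerator.\<close>
  have transfer: "expectation (\<lambda>\<omega>. indicator B (U \<omega>) * h (U \<omega>)) = (\<integral>u. indicator D u * h u \<partial>lborel) / ?c"
    if [measurable]: "h \<in> borel_measurable borel" for h :: "real \<times> real \<Rightarrow> real"
  proof -
    have "expectation (\<lambda>\<omega>. indicator B (U \<omega>) * h (U \<omega>))
        = (\<integral>u. indicator (closed_cell s) u / ?c * (indicator B u * h u) \<partial>lborel)"
      by (rule distributed_integral[OF U, symmetric]) auto
    also have "\<dots> = (\<integral>u. (indicator D u * h u) / ?c \<partial>lborel)"
    proof (rule integral_cong_AE)
      show "AE u in lborel. indicator (closed_cell s) u / ?c * (indicator B u * h u) = indicator D u * h u / ?c"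
        using cell_B by eventually_elim (simp flip: mult.assoc)
    qed auto
    finally show ?thesis by simp
  qed
  define E where "E = {\<omega> \<in> space M. shifted_grid s (U \<omega>) \<inter> ball 0 r = {}}"
  have E: "E = U -` B \<inter> space M"
    unfolding E_def B_def shifted_grid_def by blast
  then have E_meas: "E \<in> events" by simp
  have ind_E: "indicator E \<omega> = (indicator B (U \<omega>) :: real)" if "\<omega> \<in> space M" for \<omega>
    using that by (simp add: E indicator_def)
  have "prob E = expectation (indicator E)"
    using E_meas by simp
  also have "\<dots> = expectation (\<lambda>\<omega>. indicator B (U \<omega>) * 1)"
    by (intro Bochner_Integration.integral_cong) (simp_all add: ind_E)
  also have "\<dots> = measure lborel D / ?c"
    by (subst transfer) auto
  finally have prob_E: "prob E = measure lborel D / ?c" .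
  have "laplace_transform (void_conditioned M s U r) (grid_interference A) \<xi>
      = expectation (\<lambda>\<omega>. indicator E \<omega> * exp (- \<xi> * grid_interference A \<omega>)) / prob E"
    unfolding laplace_transform_def void_conditioned_def E_def[symmetric]
    using E_meas prob_E D_meas_pos c_pos
    by (intro integral_uniform_measure) (auto simp: emeasure_eq_measure)
  also have "expectation (\<lambda>\<omega>. indicator E \<omega> * exp (- \<xi> * grid_interference A \<omega>))
      = expectation (\<lambda>\<omega>. indicator B (U \<omega>) * exp (- \<xi> * grid_interference A \<omega>))"
    by (intro Bochner_Integration.integral_cong) (simp_all add: ind_E)
  also have "\<dots> = expectation (\<lambda>\<omega>. indicator B (U \<omega>) * ?g (U \<omega>))"
    by (rule expectation_exp_grid_interference[OF B_meas])
  also have "\<dots> / prob E = (\<integral>u. indicator D u * ?g u \<partial>lborel) / measure lborel D"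
    using c_pos by (simp add: transfer[OF g] prob_E)
  \<comment> \<open>The target carries the indicator of \<open>D\<close> twice, once from the set
    integral and once from the uniform law; idempotence supplies the second copy.\<close>
  also have "\<dots> = (\<integral>u. indicator D u * (indicator D u * ?g u) \<partial>lborel) / measure lborel D"
    by (simp flip: mult.assoc indicator_inter_arith)
  also have "\<dots> = (\<integral>u. indicator D u * ?g u \<partial>uniform_measure lborel D)"
    using D_pos D_fin by (intro integral_uniform_measure[symmetric]) auto
  finally show ?thesis by (simp add: set_lebesgue_integral_def)
qed

end

section \<open>Specialisation to the full and the punctured grid\<close>

theorem lemma3:
  fixes M :: "'a measure"
    and U :: "'a \<Rightarrow> real \<times> real"
    and H :: "int \<times> int \<Rightarrow> 'a \<Rightarrow> real"
    and lam pg pp \<alpha> \<eta> s \<xi> :: real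
  assumes "prob_space M"
    and "lam > 0" and "pg > 0" and "pp > 0" and "\<alpha> > 2"
    and "\<eta> = pp / pg"
    and "s = 1 / sqrt lam"
    and "\<xi> > 0"
    and "distributed M lborel U (\<lambda>u. indicator (closed_cell s) u / measure lborel (closed_cell s))"
    and "\<And>k. distributed M lborel (H k) (exponential_density 1)"
    and "prob_space.indep_vars M (\<lambda>_. borel) H UNIV"
    and "prob_space.indep_set M
            (sets (vimage_algebra (space M) U borel))
            (sets (vimage_algebra (space M) (\<lambda>\<omega> k. H k \<omega>) (Pi\<^sub>M UNIV (\<lambda>_. borel))))"
  shows "(\<forall>R>0. let D = open_cell s - ball 0 (R * \<eta> powr (- 1 / \<alpha>)) in
            emeasure lborel D > 0 \<longrightarrow>
            laplace_transform (void_conditioned M s U (R * \<eta> powr (- 1 / \<alpha>)))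
              (\<lambda>\<omega>. interference pg \<alpha> (grid_mark s (U \<omega>) (\<lambda>k. H k \<omega>)) (shifted_grid s (U \<omega>))) \<xi>
            = (LINT u':D|uniform_measure lborel D.
                 infprod (\<lambda>z. 1 / (1 + pg * \<xi> * norm (u' + lattice_point s z) powr (- \<alpha>))) UNIV))
       \<and> (AE \<omega> in M.
            cond_laplace_transform M U
              (\<lambda>\<omega>. interference pg \<alpha> (grid_mark s (U \<omega>) (\<lambda>k. H k \<omega>)) (shifted_grid s (U \<omega>) - {U \<omega>})) \<xi> \<omega>
            = infprod (\<lambda>z. 1 / (1 + pg * \<xi> * norm (U \<omega> + lattice_point s z) powr (- \<alpha>))) (UNIV - {(0, 0)}))"
proof -
  interpret prob_space M by fact
  have s: "0 < s" using assms by simp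
  \<comment> \<open>The density of the shift vanishes off the cell.\<close>
  have U_cell: "AE \<omega> in M. U \<omega> \<in> closed_cell s"
    by (subst distributed_AE2[OF assms(9)]) (auto simp: indicator_def)
  interpret marked_grid M U H s pg \<alpha> \<xi>
    by unfold_locales (use assms s U_cell distributed_measurable[OF assms(9)] in auto)
  have full: "grid_interference UNIV
      = (\<lambda>\<omega>. interference pg \<alpha> (grid_mark s (U \<omega>) (\<lambda>k. H k \<omega>)) (shifted_grid s (U \<omega>)))"
    by (simp add: grid_interference_def[abs_def] shifted_grid_def)
  have punctured: "grid_interference (UNIV - {(0, 0)})
      = (\<lambda>\<omega>. interference pg \<alpha> (grid_mark s (U \<omega>) (\<lambda>k. H k \<omega>)) (shifted_grid s (U \<omega>) - {U \<omega>}))"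
    using s by (simp add: grid_interference_def[abs_def] shifted_grid_minus)
  \<comment> \<open>The radius \<open>R * \<eta> powr (- 1 / \<alpha>)\<close> is an instance of the
    arbitrary real radius \<open>r\<close> in the void lemma.\<close>
  show ?thesis
    unfolding Let_def full[symmetric] punctured[symmetric]
    by (intro conjI allI impI void_laplace_grid_interference assms cond_laplace_grid_interference)
qed

end
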